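(* Let $G$ be an abelian group and let $\mathcal{I}$ be a linearly locally additive invariant of finite curve arrangements with values in $G$. Then there exists a unique $\alpha\in G$ such that for every finite curve arrangement $\mathcal{C}$ $$\mathcal{I}(\mathcal{C})=\alpha\cdot\Psi_2(\mathcal{C}),\qquad\Psi_2(\mathcal{C})=\sum_{v\in\operatorname{Sing}(\mathcal{C})}\binom{k_v}{2}.$$
   Context: All curve arrangements are finite and have only ordinary multiple points: every intersection is transverse, and every $k$-fold point lies on exactly $k$ distinct curves, producing exactly $2k$ local branches (half-branches). $\operatorname{Sing}(\mathcal{C})$ is the set of points lying on at least two curves of $\mathcal{C}$, and $k_v$ is the number of curves through $v$. For a component $H\in\mathcal{C}$, $\operatorname{Loc}(H,\mathcal{C})$ is the multiset containing, for each $v\in H\cap\operatorname{Sing}(\mathcal{C})$, one copy of the number $d_v$ of local branches of curves of $\mathcal{C}$ at $v$ (so $d_v=2k_v$). An invariant $\mathcal{I}$ from finite curve arrangements to an abelian group $G$ is linearly locally additive if: (1) $\mathcal{I}(\emptyset)=0$; (2) there is a function $F_{\mathcal{I}}$ depending only on $\operatorname{Loc}(H,\mathcal{C})$ such that $\mathcal{I}(\mathcal{C})-\mathcal{I}(\mathcal{C}\setminus H)=F_{\mathcal{I}}(\operatorname{Loc}(H,\mathcal{C}))$ for every arrangement $\mathcal{C}$ and component $H\in\mathcal{C}$; (3) $\mathcal{I}(\mathcal{C}_1\sqcup\mathcal{C}_2)=\mathcal{I}(\mathcal{C}_1)+\mathcal{I}(\mathcal{C}_2)$ for disjoint unions; (4)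 $F_{\mathcal{I}}(\operatorname{Loc}(H,\mathcal{C}))=\sum_{v\in H\cap\operatorname{Sing}(\mathcal{C})}F_{\mathcal{I}}(\{d_v\})$; (5) there is a fixed $\alpha\in G$ such that $F_{\mathcal{I}}(\{d\})=\alpha\cdot\frac{d-2}{2}$ for every node with local branch number $d=2j$, $j\ge2$; equivalently $F_{\mathcal{I}}(\{2j\})=\alpha(j-1)$. *)

theory Defs
  imports "HOL-Analysis.Analysis" "HOL-Library.Multiset"
begin

section \<open>Curves on surfaces\<close>

text \<open>The ambient space is an arbitrary surface embedded in some Euclidean space. The regularity
  class is \<open>C\<^sup>1\<close>, the least one in which transversality makes sense.\<close>

definition regular_param :: "('b::euclidean_space \<Rightarrow> 'a::euclidean_space) \<Rightarrow> 'b set \<Rightarrow> 'a set \<Rightarrow> bool"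
  where "regular_param \<phi> W V \<longleftrightarrow>
     open W \<and> (\<exists>\<psi>. homeomorphism W V \<phi> \<psi>) \<and>
     (\<exists>\<phi>' :: 'b \<Rightarrow> 'b \<Rightarrow>\<^sub>L 'a. continuous_on W \<phi>' \<and>
        (\<forall>x\<in>W. (\<phi> has_derivative blinfun_apply (\<phi>' x)) (at x) \<and> inj (blinfun_apply (\<phi>' x))))"

definition C1_surface :: "'a::euclidean_space set \<Rightarrow> bool"
  where "C1_surface S \<longleftrightarrow> S \<noteq> {} \<and>
     (\<forall>p\<in>S. \<exists>(\<phi> :: real^2 \<Rightarrow> 'a) W V. openin (top_of_set S) V \<and> p \<in> V \<and> regular_param \<phi> W V)"

text \<open>Curves have no boundary and no self-crossings. Neither connectedness nor compactness is
  required, so that lines, circles, hyperbolas and open arcs are all curves.\<close>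

definition C1_curve :: "'a::euclidean_space set \<Rightarrow> bool"
  where "C1_curve c \<longleftrightarrow> c \<noteq> {} \<and>
     (\<forall>p\<in>c. \<exists>(\<gamma> :: real \<Rightarrow> 'a) W V. openin (top_of_set c) V \<and> p \<in> V \<and> regular_param \<gamma> W V)"

definition tangent_space :: "'a::euclidean_space set \<Rightarrow> 'a \<Rightarrow> 'a set"
  where "tangent_space M p =
     {u. \<exists>\<gamma> :: real \<Rightarrow> 'a. \<gamma> 0 = p \<and> (\<forall>\<^sub>F t in at 0. \<gamma> t \<in> M) \<and> (\<gamma> has_vector_derivative u) (at 0)}"

definition transverse_at :: "'a::euclidean_space set \<Rightarrow> 'a set \<Rightarrow> 'a set \<Rightarrow> 'a \<Rightarrow> bool"
  where "transverse_at S c c' p \<longleftrightarrow>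
     {u + w | u w. u \<in> tangent_space c p \<and> w \<in> tangent_space c' p} = tangent_space S p"

text \<open>The local branches (half-branches) of \<open>c\<close> at \<open>v\<close> are the components, in a small punctured
  neighbourhood of \<open>v\<close>, that reach \<open>v\<close>.\<close>

definition half_branches :: "'a::euclidean_space set \<Rightarrow> 'a \<Rightarrow> nat"
  where "half_branches c v =
     (THE n. \<forall>\<^sub>F e in at_right 0.
        card {K \<in> components (c \<inter> ball v e - {v}). v \<in> closure K} = n)"


section \<open>Arrangements\<close>

definition Sing :: "'a set set \<Rightarrow> 'a set"
  where "Sing C = {v. \<exists>c\<in>C. \<exists>c'\<in>C. c \<noteq> c' \<and> v \<in> c \<and> v \<in> c'}"

definition num_curves :: "'a set set \<Rightarrow> 'a \<Rightarrow> nat"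
  where "num_curves C v = card {c \<in> C. v \<in> c}"

definition branch_number :: "'a::euclidean_space set set \<Rightarrow> 'a \<Rightarrow> nat"
  where "branch_number C v = (\<Sum>c | c \<in> C \<and> v \<in> c. half_branches c v)"

text \<open>The \<open>closedin\<close> clause says that no curve has an end converging to a point of another curve
  without passing through it; such an end would be an additional local branch at that point.\<close>

definition curve_arrangement :: "'a::euclidean_space set \<Rightarrow> 'a set set \<Rightarrow> bool"
  where "curve_arrangement S C \<longleftrightarrow>
     finite C \<and> (\<forall>c\<in>C. C1_curve c \<and> c \<subseteq> S) \<and>
     finite (Sing C) \<and>
     (\<forall>c\<in>C. \<forall>c'\<in>C. \<forall>p. c \<noteq> c' \<and> p \<in> c \<and> p \<in> c' \<longrightarrow> transverse_at S c c' p) \<and>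
     (\<forall>c\<in>C. closedin (top_of_set (\<Union>C)) c) \<and>
     (\<forall>v\<in>Sing C. branch_number C v = 2 * num_curves C v)"

definition Loc :: "'a::euclidean_space set \<Rightarrow> 'a set set \<Rightarrow> nat multiset"
  where "Loc H C = image_mset (branch_number C) (mset_set (H \<inter> Sing C))"

definition Psi2 :: "'a set set \<Rightarrow> nat"
  where "Psi2 C = (\<Sum>v\<in>Sing C. num_curves C v choose 2)"


section \<open>Linearly locally additive invariants\<close>

definition nat_multiple :: "'g::ab_group_add \<Rightarrow> nat \<Rightarrow> 'g"
  where "nat_multiple \<alpha> n = (\<Sum>i<n. \<alpha>)"

text \<open>Invariants are arbitrary functions: no invariance under homeomorphism or isotopy is
  assumed, and values outside \<open>curve_arrangement S\<close> are irrelevant. In a disjoint union no curve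
  of one arrangement meets a curve of the other.\<close>

definition linearly_locally_additive ::
    "'a::euclidean_space set \<Rightarrow> ('a set set \<Rightarrow> 'g::ab_group_add) \<Rightarrow> bool"
  where "linearly_locally_additive S I \<longleftrightarrow>
     I {} = 0 \<and>
     (\<forall>C1 C2. curve_arrangement S C1 \<and> curve_arrangement S C2 \<and>
        curve_arrangement S (C1 \<union> C2) \<and> \<Union>C1 \<inter> \<Union>C2 = {} \<longrightarrow> I (C1 \<union> C2) = I C1 + I C2) \<and>
     (\<exists>F :: nat multiset \<Rightarrow> 'g.
        (\<forall>C H. curve_arrangement S C \<and> H \<in> C \<longrightarrow> I C - I (C - {H}) = F (Loc H C)) \<and>
        (\<forall>C H. curve_arrangement S C \<and> H \<in> C \<longrightarrow>
           F (Loc H C) = (\<Sum>v\<in>H \<inter> Sing C. F {#branch_number C v#})) \<and>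
        (\<exists>\<alpha>. \<forall>j\<ge>2. F {#2 * j#} = nat_multiple \<alpha> (j - 1)))"

end

theory Submission
  imports Defs
begin

text \<open>
  Deleting a curve \<open>H\<close> from an arrangement lowers \<open>k\<^sub>v\<close> by one at each \<open>v \<in> H\<close>, and
  \<open>(k choose 2) - ((k - 1) choose 2) = k - 1\<close>. So \<open>\<Psi>\<^sub>2\<close> drops by the sum of the numbers
  \<open>k\<^sub>v - 1\<close> over the singular points on \<open>H\<close>, while the axioms say that \<open>I\<close> drops by \<open>\<alpha>\<close>
  times the same sum. Deleting the curves one at a time down to \<open>I {} = 0\<close> gives
  \<open>I = \<alpha> \<cdot> \<Psi>\<^sub>2\<close>; this is \<open>invariant_eq_multiple_Psi2\<close>.

  The intermediate families must again be arrangements. The only condition that is not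
  visibly inherited is the one on branch numbers: if \<open>H\<close> contributed a number of half-branches
  other than two at \<open>v\<close>, the remaining curves would contribute a wrong total. This cannot
  happen, because a curve without boundary is locally an open interval and has exactly two
  half-branches at every point (\<open>eventually_two_branches\<close>); hence the condition on branch
  numbers holds for every family of such curves.

  Uniqueness of \<open>\<alpha>\<close> needs an arrangement in \<open>S\<close> with \<open>\<Psi>\<^sub>2 = 1\<close>, whose value is then \<open>\<alpha>\<close>
  itself; an arrangement with \<open>\<Psi>\<^sub>2 = m\<close> determines \<open>\<alpha>\<close> only up to \<open>m\<close>-torsion.
  The images of two short perpendicular segments under a chart of \<open>S\<close> form one
  (\<open>exists_crossing\<close>). Their transversality rests on the identification of the tangent space
  of \<open>S\<close>, defined by velocities of arbitrary paths, with the range of the derivative of the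
  chart (\<open>tangent_spaceI\<close>, \<open>tangent_space_subset_range\<close>).
\<close>

section \<open>Multiples in an abelian group\<close>

lemma nat_multiple_0 [simp]: "nat_multiple \<alpha> 0 = 0"
  by (simp add: nat_multiple_def)

lemma nat_multiple_1 [simp]: "nat_multiple \<alpha> (Suc 0) = \<alpha>"
  by (simp add: nat_multiple_def)

lemma nat_multiple_add: "nat_multiple \<alpha> (m + n) = nat_multiple \<alpha> m + nat_multiple \<alpha> n"
  by (induction n) (simp_all add: nat_multiple_def algebra_simps)

lemma nat_multiple_sum:
  "nat_multiple \<alpha> (\<Sum>x\<in>A. f x) = (\<Sum>x\<in>A. nat_multiple \<alpha> (f x))"
  by (induction A rule: infinite_finite_induct) (simp_all add: nat_multiple_add)


section \<open>A curve has two half-branches at each of its points\<close>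

text \<open>Under a local parametrization \<open>\<gamma>\<close> with \<open>\<gamma> t\<^sub>0 = v\<close>, the images \<open>L\<close> and \<open>R\<close> of small
  intervals to the left and to the right of \<open>t\<^sub>0\<close> are connected and together form a punctured
  neighbourhood of \<open>v\<close>. A component that reaches \<open>v\<close> must therefore contain \<open>L\<close> or \<open>R\<close>, and none
  contains both, since its preimage would be an interval running through \<open>t\<^sub>0\<close>. The intersection
  with a ball may well have further components, but these stay away from \<open>v\<close>.\<close>

lemma eventually_two_branches:
  fixes c :: "'a::euclidean_space set"
  assumes "C1_curve c" and "v \<in> c"
  shows "\<forall>\<^sub>F e in at_right 0. card {K \<in> components (c \<inter> ball v e - {v}). v \<in> closure K} = 2"
proof -
  obtain \<gamma> :: "real \<Rightarrow> 'a" and W V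
    where V: "openin (top_of_set c) V" "v \<in> V" and "regular_param \<gamma> W V"
    using assms unfolding C1_curve_def by meson
  then obtain \<psi> where W: "open W" and hom: "homeomorphism W V \<gamma> \<psi>"
    unfolding regular_param_def by blast
  obtain T where T: "open T" "V = c \<inter> T"
    using V(1) by (meson openin_open)
  then obtain e0 where e0: "e0 > 0" "ball v e0 \<subseteq> T"
    using V(2) by (meson IntD2 openE)
  have key: "card {K \<in> components (c \<inter> ball v e - {v}). v \<in> closure K} = 2"
    if e: "0 < e" "e < e0" for e
  proof -
    define M where "M = c \<inter> ball v e - {v}"
    define t0 where "t0 = \<psi> v"
    have MV: "c \<inter> ball v e \<subseteq> V"
      using e e0 T(2) by auto
    have t0: "t0 \<in> W" "\<gamma> t0 = v"
      using hom V(2) by (auto simp: homeomorphism_def t0_def)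
    have cont: "continuous_on W \<gamma>" and cont': "continuous_on V \<psi>"
      and \<psi>\<gamma>: "\<And>t. t \<in> W \<Longrightarrow> \<psi> (\<gamma> t) = t" and \<gamma>\<psi>: "\<And>y. y \<in> V \<Longrightarrow> \<gamma> (\<psi> y) = y"
      and \<gamma>V: "\<And>t. t \<in> W \<Longrightarrow> \<gamma> t \<in> V"
      using hom by (auto simp: homeomorphism_def)
    have "open (W \<inter> \<gamma> -` ball v e)"
      using continuous_open_preimage[OF cont W] by auto
    moreover have "t0 \<in> W \<inter> \<gamma> -` ball v e"
      using t0 e by auto
    ultimately obtain d where d: "d > 0" "ball t0 d \<subseteq> W \<inter> \<gamma> -` ball v e"
      by (meson openE)
    define L where "L = \<gamma> ` {t0 - d<..<t0}"
    define R where "R = \<gamma> ` {t0<..<t0 + d}"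
    have sub: "{t0 - d<..<t0} \<subseteq> ball t0 d" "{t0<..<t0 + d} \<subseteq> ball t0 d"
      by (auto simp: dist_real_def)
    have "connected L" "connected R"
      unfolding L_def R_def using sub d(2)
      by (auto intro!: connected_continuous_image continuous_on_subset[OF cont])
    have inM: "\<gamma> t \<in> M" if "t \<in> ball t0 d" "t \<noteq> t0" for t
      using that d(2) \<gamma>V[of t] T(2) \<psi>\<gamma>[of t] t0 \<psi>\<gamma>[of t0] by (auto simp: M_def)
    have LM: "L \<subseteq> M" and RM: "R \<subseteq> M"
      unfolding L_def R_def using sub by (auto intro!: inM)
    obtain l where l: "l \<in> L" using d(1) by (force simp: L_def)
    obtain r where r: "r \<in> R" using d(1) by (force simp: R_def)
    define KL where "KL = connected_component_set M l"
    define KR where "KR = connected_component_set M r"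
    have LKL: "L \<subseteq> KL" and RKR: "R \<subseteq> KR"
      unfolding KL_def KR_def
      using connected_component_maximal \<open>connected L\<close> \<open>connected R\<close> l r LM RM by blast+
    have comp: "KL \<in> components M" "KR \<in> components M"
      unfolding KL_def KR_def using l r LM RM by (auto intro: componentsI)
    have isc: "isCont \<gamma> t0"
      using cont W t0(1) continuous_on_eq_continuous_at by blast
    have clos: "v \<in> closure (\<gamma> ` A)" if "t0 \<in> closure A" for A
    proof -
      obtain s where s: "\<And>n. s n \<in> A" "s \<longlonglongrightarrow> t0"
        using \<open>t0 \<in> closure A\<close> unfolding closure_sequential by blast
      have "(\<lambda>n. \<gamma> (s n)) \<longlonglongrightarrow> v"
        using isCont_tendsto_compose[OF isc s(2)] t0(2) by simp
      then show ?thesis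
        unfolding closure_sequential using s(1) by (intro exI[of _ "\<lambda>n. \<gamma> (s n)"]) simp
    qed
    have vL: "v \<in> closure KL"
      using clos[of "{t0 - d<..<t0}"] d(1) closure_mono[OF LKL] by (auto simp: L_def)
    have vR: "v \<in> closure KR"
      using clos[of "{t0<..<t0 + d}"] d(1) closure_mono[OF RKR] by (auto simp: R_def)
    have "KL \<noteq> KR"
    proof
      assume eq: "KL = KR"
      have "KL \<subseteq> M" "connected KL"
        using comp(1) in_components_subset in_components_connected by blast+
      then have "connected (\<psi> ` KL)"
        using MV by (intro connected_continuous_image continuous_on_subset[OF cont'])
          (auto simp: M_def)
      moreover have "\<psi> l \<in> \<psi> ` KL" "\<psi> r \<in> \<psi> ` KL"
        using l r LKL RKR eq by auto
      moreover have "\<psi> l < t0"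
        using l sub d(2) \<psi>\<gamma> by (auto simp: L_def subset_iff)
      moreover have "t0 < \<psi> r"
        using r sub d(2) \<psi>\<gamma> by (auto simp: R_def subset_iff)
      ultimately have "t0 \<in> \<psi> ` KL"
        by (meson connected_contains_Icc atLeastAtMost_iff less_imp_le subsetD)
      then obtain y where "y \<in> M" "\<psi> y = t0"
        using \<open>KL \<subseteq> M\<close> by auto
      then show False
        using \<gamma>\<psi>[of y] MV t0(2) by (auto simp: M_def)
    qed
    moreover have "{K \<in> components M. v \<in> closure K} = {KL, KR}"
    proof (intro equalityI subsetI)
      fix K assume "K \<in> {K \<in> components M. v \<in> closure K}"
      then have K: "K \<in> components M" "v \<in> closure K" by auto
      then have "K \<subseteq> M" by (simp add: in_components_subset)
      obtain s where s: "\<And>n::nat. s n \<in> K" "s \<longlonglongrightarrow> v"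
        using K(2) unfolding closure_sequential by blast
      have sV: "s n \<in> V" for n
        using s(1) \<open>K \<subseteq> M\<close> MV by (auto simp: M_def)
      have "(\<lambda>n. \<psi> (s n)) \<longlonglongrightarrow> t0"
        unfolding t0_def
        by (rule continuous_on_tendsto_compose[OF cont' s(2) V(2)]) (simp add: sV)
      then have "\<forall>\<^sub>F n in sequentially. dist (\<psi> (s n)) t0 < d"
        using d(1) by (simp add: tendsto_iff)
      then obtain n where n: "dist (\<psi> (s n)) t0 < d"
        using eventually_happens'[OF sequentially_bot] by blast
      have "s n \<noteq> v" using s(1) \<open>K \<subseteq> M\<close> by (auto simp: M_def)
      then have "\<psi> (s n) \<noteq> t0" using \<gamma>\<psi>[OF sV] t0(2) by metis
      then have "\<psi> (s n) \<in> {t0 - d<..<t0} \<or> \<psi> (s n) \<in> {t0<..<t0 + d}"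
        using n by (auto simp: dist_real_def)
      then have "s n \<in> L \<or> s n \<in> R"
        unfolding L_def R_def using \<gamma>\<psi>[OF sV] by (metis image_eqI)
      then have "s n \<in> KL \<or> s n \<in> KR" using LKL RKR by blast
      then show "K \<in> {KL, KR}"
        using components_nonoverlap[OF K(1) comp(1)] components_nonoverlap[OF K(1) comp(2)] s(1)
        by blast
    qed (use comp vL vR in auto)
    ultimately show ?thesis
      by (simp add: M_def)
  qed
  show ?thesis
    unfolding eventually_at_right_field using key e0(1) by blast
qed

lemma half_branches_eq_2:
  assumes "C1_curve c" and "v \<in> c"
  shows "half_branches c v = 2"
  unfolding half_branches_def
proof (rule the_equality)
  show "\<forall>\<^sub>F e in at_right 0. card {K \<in> components (c \<inter> ball v e - {v}). v \<in> closure K} = 2"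
    using eventually_two_branches[OF assms] .
next
  fix n
  assume "\<forall>\<^sub>F e in at_right 0. card {K \<in> components (c \<inter> ball v e - {v}). v \<in> closure K} = n"
  with eventually_two_branches[OF assms]
  have "\<forall>\<^sub>F e in at_right (0::real). n = 2"
    by eventually_elim simp
  then show "n = 2"
    by simp
qed

lemma branch_number_eq:
  assumes "\<And>c. c \<in> C \<Longrightarrow> C1_curve c"
  shows "branch_number C v = 2 * num_curves C v"
proof -
  have "branch_number C v = (\<Sum>c | c \<in> C \<and> v \<in> c. 2)"
    unfolding branch_number_def by (rule sum.cong) (auto simp: assms half_branches_eq_2)
  then show ?thesis by (simp add: num_curves_def)
qed


section \<open>Deleting a curve from an arrangement\<close>

lemma curve_arrangement_subset:
  assumes C: "curve_arrangement S C" and "D \<subseteq> C"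
  shows "curve_arrangement S D"
proof -
  have curves: "\<forall>c\<in>C. C1_curve c \<and> c \<subseteq> S"
    and transverse: "\<forall>c\<in>C. \<forall>c'\<in>C. \<forall>p. c \<noteq> c' \<and> p \<in> c \<and> p \<in> c' \<longrightarrow> transverse_at S c c' p"
    using C by (simp_all add: curve_arrangement_def)
  have "Sing D \<subseteq> Sing C"
    using assms(2) by (auto simp: Sing_def)
  then have "finite (Sing D)"
    using C finite_subset by (auto simp: curve_arrangement_def)
  moreover have "closedin (top_of_set (\<Union>D)) c" if "c \<in> D" for c
  proof (rule closedin_subset_trans)
    show "closedin (top_of_set (\<Union>C)) c"
      using that assms by (auto simp: curve_arrangement_def)
  qed (use that assms(2) in auto)
  moreover have "branch_number D v = 2 * num_curves D v" for v
    using assms by (intro branch_number_eq) (auto simp: curve_arrangement_def)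
  moreover have "finite D"
    using assms by (auto simp: curve_arrangement_def intro: finite_subset)
  moreover have "\<forall>c\<in>D. C1_curve c \<and> c \<subseteq> S"
    using curves \<open>D \<subseteq> C\<close> by (meson subsetD)
  moreover have "\<forall>c\<in>D. \<forall>c'\<in>D. \<forall>p. c \<noteq> c' \<and> p \<in> c \<and> p \<in> c' \<longrightarrow> transverse_at S c c' p"
    using transverse \<open>D \<subseteq> C\<close> by (meson subsetD)
  ultimately show ?thesis
    unfolding curve_arrangement_def by simp
qed

lemma Sing_iff_num_curves:
  assumes "finite C"
  shows "v \<in> Sing C \<longleftrightarrow> 2 \<le> num_curves C v"
proof -
  have "2 \<le> num_curves C v \<longleftrightarrow> \<not> card {c \<in> C. v \<in> c} \<le> Suc 0"
    by (auto simp: num_curves_def)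
  also have "\<dots> \<longleftrightarrow> v \<in> Sing C"
    using assms by (subst card_le_Suc0_iff_eq) (auto simp: Sing_def)
  finally show ?thesis by simp
qed

text \<open>The right-hand sum is the sum of the weights \<open>(d\<^sub>v - 2) / 2\<close> that linear local additivity
  attaches to the singular points on \<open>H\<close>.\<close>

lemma Psi2_remove:
  assumes "finite C" "finite (Sing C)" "H \<in> C"
  shows "Psi2 C = Psi2 (C - {H}) + (\<Sum>v\<in>H \<inter> Sing C. num_curves C v - 1)"
proof -
  let ?D = "C - {H}"
  have step: "num_curves C v choose 2 =
      (num_curves ?D v choose 2) + (if v \<in> H then num_curves C v - 1 else 0)" for v
  proof (cases "v \<in> H")
    case True
    then have "{c \<in> C. v \<in> c} = insert H {c \<in> ?D. v \<in> c}"
      using assms(3) by auto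
    then have "num_curves C v = Suc (num_curves ?D v)"
      using assms(1) by (simp add: num_curves_def)
    then show ?thesis using True by (simp add: numeral_2_eq_2)
  next
    case False
    then have "{c \<in> C. v \<in> c} = {c \<in> ?D. v \<in> c}" by auto
    then show ?thesis using False by (simp add: num_curves_def)
  qed
  \<comment> \<open>A double point on \<open>H\<close> is no longer singular after the deletion, but \<open>1 choose 2 = 0\<close>.\<close>
  have "(\<Sum>v\<in>Sing C. num_curves ?D v choose 2) = Psi2 ?D"
    unfolding Psi2_def
  proof (rule sum.mono_neutral_right[OF assms(2)])
    show "Sing ?D \<subseteq> Sing C" by (auto simp: Sing_def)
    show "\<forall>v\<in>Sing C - Sing ?D. num_curves ?D v choose 2 = 0"
      using assms(1) Sing_iff_num_curves[of ?D] by (auto intro!: binomial_eq_0)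
  qed
  moreover have "(\<Sum>v\<in>Sing C. if v \<in> H then num_curves C v - 1 else 0)
      = (\<Sum>v\<in>H \<inter> Sing C. num_curves C v - 1)"
    unfolding Int_commute[of H] by (simp only: sum.inter_restrict[OF assms(2)])
  ultimately show ?thesis
    by (simp add: Psi2_def[of C] step sum.distrib)
qed

lemma invariant_eq_multiple_Psi2:
  assumes empty: "I {} = 0"
    and remove: "\<And>C H. curve_arrangement S C \<Longrightarrow> H \<in> C \<Longrightarrow>
      I C - I (C - {H}) = (\<Sum>v\<in>H \<inter> Sing C. F {#branch_number C v#})"
    and F: "\<And>j. j \<ge> 2 \<Longrightarrow> F {#2 * j#} = nat_multiple \<alpha> (j - 1)"
    and "curve_arrangement S C"
  shows "I C = nat_multiple \<alpha> (Psi2 C)"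
proof -
  have "finite C" using assms(4) by (simp add: curve_arrangement_def)
  then show ?thesis using assms(4)
  proof (induction C)
    case empty
    then show ?case by (simp add: assms(1) Psi2_def Sing_def)
  next
    case (insert H D)
    let ?C = "insert H D"
    have D: "?C - {H} = D" using insert.hyps(2) by auto
    have fin: "finite ?C" "finite (Sing ?C)"
      using insert.prems by (auto simp: curve_arrangement_def)
    have "I D = nat_multiple \<alpha> (Psi2 D)"
      using insert.IH curve_arrangement_subset[OF insert.prems] by blast
    moreover have "I ?C - I D = (\<Sum>v\<in>H \<inter> Sing ?C. F {#branch_number ?C v#})"
      using remove[OF insert.prems, of H] D by simp
    moreover have "\<dots> = (\<Sum>v\<in>H \<inter> Sing ?C. nat_multiple \<alpha> (num_curves ?C v - 1))"
    proof (rule sum.cong)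
      fix v assume "v \<in> H \<inter> Sing ?C"
      then have "branch_number ?C v = 2 * num_curves ?C v" "2 \<le> num_curves ?C v"
        using insert.prems Sing_iff_num_curves[OF fin(1)] by (auto simp: curve_arrangement_def)
      then show "F {#branch_number ?C v#} = nat_multiple \<alpha> (num_curves ?C v - 1)"
        using F by simp
    qed simp
    moreover have "Psi2 ?C = Psi2 D + (\<Sum>v\<in>H \<inter> Sing ?C. num_curves ?C v - 1)"
      using Psi2_remove[OF fin, of H] D by simp
    ultimately show ?case
      by (simp add: nat_multiple_add nat_multiple_sum algebra_simps)
  qed
qed


section \<open>Two arcs crossing once in a surface\<close>

lemma tangent_space_mono: "M \<subseteq> N \<Longrightarrow> tangent_space M p \<subseteq> tangent_space N p"
  unfolding tangent_space_def by (force elim: eventually_mono)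

lemma tangent_spaceI:
  fixes \<phi> :: "'b::real_normed_vector \<Rightarrow> 'a::euclidean_space"
  assumes der: "(\<phi> has_derivative A) (at x)"
    and ev: "\<forall>\<^sub>F t in at 0. \<phi> (x + t *\<^sub>R h) \<in> M"
  shows "A h \<in> tangent_space M (\<phi> x)"
  unfolding tangent_space_def
proof (intro CollectI exI conjI)
  let ?\<gamma> = "\<lambda>t. \<phi> (x + t *\<^sub>R h)"
  show "?\<gamma> 0 = \<phi> x" by simp
  have "((\<lambda>t. x + t *\<^sub>R h) has_derivative (\<lambda>t. t *\<^sub>R h)) (at 0)"
    by (auto intro!: derivative_eq_intros)
  then have "(?\<gamma> has_derivative (\<lambda>t. A (t *\<^sub>R h))) (at 0)"
    by (rule has_derivative_compose) (simp add: der)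
  then show "(?\<gamma> has_vector_derivative A h) (at 0)"
    using linear_scale[OF has_derivative_linear[OF der]] by (simp add: has_vector_derivative_def)
qed (rule ev)

text \<open>A path \<open>\<gamma>\<close> in \<open>S\<close> is only continuous when read in the chart, as \<open>\<eta> = \<psi> \<circ> \<gamma>\<close>, so the chain
  rule does not apply to \<open>\<gamma> = \<phi> \<circ> \<eta>\<close>. But \<open>A\<close> is injective, hence bounded below, which
  bounds \<open>\<eta> t - x\<close> by a multiple of \<open>t\<close>. So the vectors \<open>A ((\<eta> t - x) / t)\<close> approximate the
  velocity \<open>u\<close>, and the range of \<open>A\<close> is closed.\<close>

lemma tangent_space_subset_range:
  fixes \<phi> :: "'b::euclidean_space \<Rightarrow> 'a::euclidean_space"
  assumes V: "openin (top_of_set S) V" and hom: "homeomorphism W V \<phi> \<psi>" and x: "x \<in> W"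
    and der: "(\<phi> has_derivative A) (at x)" and "inj A"
  shows "tangent_space S (\<phi> x) \<subseteq> range A"
proof
  fix u assume "u \<in> tangent_space S (\<phi> x)"
  then obtain \<gamma> :: "real \<Rightarrow> 'a" where \<gamma>: "\<gamma> 0 = \<phi> x" "\<forall>\<^sub>F t in at 0. \<gamma> t \<in> S"
    and \<gamma>': "(\<gamma> has_vector_derivative u) (at 0)"
    unfolding tangent_space_def by blast
  have lin: "linear A" using der by (rule has_derivative_linear)
  obtain B where B: "B > 0" "\<And>h. B * norm h \<le> norm (A h)"
    using linear_inj_bounded_below_pos[OF lin \<open>inj A\<close>] by blast
  have \<gamma>der: "(\<gamma> has_derivative (\<lambda>t. t *\<^sub>R u)) (at 0)"
    using \<gamma>' by (simp add: has_vector_derivative_def)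
  have conv: "(\<gamma> \<longlongrightarrow> \<phi> x) (at 0)"
    using has_derivative_continuous[OF \<gamma>der] \<gamma>(1) by (simp add: isCont_def)
  have \<phi>x: "\<phi> x \<in> V" "\<psi> (\<phi> x) = x" using hom x by (auto simp: homeomorphism_def)
  obtain T where T: "open T" "V = S \<inter> T" using V by (meson openin_open)
  have "\<forall>\<^sub>F t in at 0. \<gamma> t \<in> T"
    using topological_tendstoD[OF conv T(1)] \<phi>x T(2) by simp
  with \<gamma>(2) have evV: "\<forall>\<^sub>F t in at 0. \<gamma> t \<in> V"
    by eventually_elim (simp add: T(2))
  define \<eta> where "\<eta> t = \<psi> (\<gamma> t)" for t
  have "(\<eta> \<longlongrightarrow> \<psi> (\<phi> x)) (at 0)"
    unfolding \<eta>_def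
    by (rule continuous_on_tendsto_compose[OF _ conv \<phi>x(1) evV])
      (use hom in \<open>simp add: homeomorphism_def\<close>)
  then have \<eta>: "(\<eta> \<longlongrightarrow> x) (at 0)" by (simp add: \<phi>x)
  have "u \<in> closure (range A)"
    unfolding closure_approachable
  proof (intro allI impI)
    fix e :: real assume e: "e > 0"
    \<comment> \<open>The linearization errors \<open>k \<bar>t\<bar>\<close> of \<open>\<gamma>\<close> and \<open>k (norm h)\<close> of \<open>\<phi>\<close>, where \<open>h = \<eta> t - x\<close>, add up
      to at most \<open>k D \<bar>t\<bar>\<close>; the bound \<open>k \<le> B / 2\<close> lets \<open>A h\<close> dominate the error of \<open>\<phi>\<close>.\<close>
    define D where "D = 1 + 2 / B * (norm u + 1)"
    have D: "D > 0" using B(1) by (simp add: D_def add_pos_nonneg)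
    define k where "k = min (min 1 (B / 2)) (e / (2 * D))"
    have k: "0 < k" "k \<le> 1" "k \<le> B / 2" "k \<le> e / (2 * D)"
      using B(1) e D by (auto simp: k_def)
    obtain d1 where d1: "d1 > 0"
      "\<And>y. norm (y - x) < d1 \<Longrightarrow> norm (\<phi> y - \<phi> x - A (y - x)) \<le> k * norm (y - x)"
      using der k(1) unfolding has_derivative_at_alt by blast
    obtain d2 where d2: "d2 > 0"
      "\<And>t. norm (t - 0) < d2 \<Longrightarrow> norm (\<gamma> t - \<gamma> 0 - (t - 0) *\<^sub>R u) \<le> k * norm (t - 0)"
      using \<gamma>der k(1) unfolding has_derivative_at_alt by blast
    have "\<forall>\<^sub>F t in at 0. dist (\<eta> t) x < d1"
      using \<eta> d1(1) by (rule tendstoD)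
    moreover have "\<forall>\<^sub>F t in at 0. dist t 0 < d2"
      using tendsto_ident_at d2(1) by (rule tendstoD)
    moreover have "\<forall>\<^sub>F t :: real in at 0. t \<noteq> 0"
      by (rule eventually_neq_at_within)
    ultimately have "\<forall>\<^sub>F t in at 0. \<gamma> t \<in> V \<and> dist (\<eta> t) x < d1 \<and> dist t 0 < d2 \<and> t \<noteq> 0"
      using evV by eventually_elim simp
    then obtain t where t: "\<gamma> t \<in> V" "dist (\<eta> t) x < d1" "dist t 0 < d2" "t \<noteq> 0"
      using eventually_happens'[OF at_neq_bot] by force
    define h where "h = \<eta> t - x"
    have \<phi>\<eta>: "\<phi> (\<eta> t) = \<gamma> t"
      using t(1) hom by (simp add: \<eta>_def homeomorphism_def)
    have 1: "norm (\<gamma> t - \<phi> x - A h) \<le> k * norm h"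
      using d1(2)[of "\<eta> t"] t(2) by (simp add: \<phi>\<eta> h_def dist_norm)
    have 2: "norm (\<gamma> t - \<phi> x - t *\<^sub>R u) \<le> k * \<bar>t\<bar>"
      using d2(2)[of t] t(3) by (simp add: \<gamma>(1))
    have "norm (A h) \<le> norm (\<gamma> t - \<phi> x) + norm (\<gamma> t - \<phi> x - A h)"
      using norm_triangle_sub[of "A h" "\<gamma> t - \<phi> x"] by (simp add: norm_minus_commute)
    moreover have "k * norm h \<le> B / 2 * norm h"
      using k(3) by (rule mult_right_mono) simp
    ultimately have "B / 2 * norm h \<le> norm (\<gamma> t - \<phi> x)"
      using 1 B(2)[of h] by (simp add: field_simps)
    also have "\<dots> \<le> norm (t *\<^sub>R u) + norm (\<gamma> t - \<phi> x - t *\<^sub>R u)"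
      by (rule norm_triangle_sub)
    also have "\<dots> \<le> \<bar>t\<bar> * norm u + 1 * \<bar>t\<bar>"
      using 2 mult_right_mono[OF k(2), of "\<bar>t\<bar>"] by simp
    finally have h: "norm h \<le> 2 / B * (norm u + 1) * \<bar>t\<bar>"
      using B(1) by (simp add: field_simps)
    have "norm (A h - t *\<^sub>R u) \<le> norm (\<gamma> t - \<phi> x - t *\<^sub>R u) + norm (\<gamma> t - \<phi> x - A h)"
      using norm_triangle_ineq4[of "\<gamma> t - \<phi> x - t *\<^sub>R u" "\<gamma> t - \<phi> x - A h"] by simp
    also have "\<dots> \<le> k * \<bar>t\<bar> + k * (2 / B * (norm u + 1) * \<bar>t\<bar>)"
      using 1 2 mult_left_mono[OF h, of k] k(1) by linarith
    also have "\<dots> = k * D * \<bar>t\<bar>"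
      by (simp add: D_def algebra_simps)
    also have "\<dots> \<le> e / 2 * \<bar>t\<bar>"
      using k(4) D by (intro mult_right_mono) (simp_all add: field_simps)
    also have "\<dots> < e * \<bar>t\<bar>" using e t(4) by simp
    finally have main: "norm (A h - t *\<^sub>R u) < e * \<bar>t\<bar>" .
    have "A (h /\<^sub>R t) - u = (A h - t *\<^sub>R u) /\<^sub>R t"
      using t(4) by (simp add: linear_scale[OF lin] scaleR_diff_right)
    then have "dist (A (h /\<^sub>R t)) u = norm (A h - t *\<^sub>R u) / \<bar>t\<bar>"
      by (simp add: dist_norm divide_inverse mult.commute)
    also have "\<dots> < e" using main t(4) by (simp add: divide_less_eq)
    finally show "\<exists>y\<in>range A. dist y u < e" by blast
  qed
  moreover have "closed (range A)"
    by (intro closed_subspace linear_subspace_image lin subspace_UNIV)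
  ultimately show "u \<in> range A" by simp
qed

text \<open>The image under a regular parametrization of an open segment through \<open>x\<close> in the unit
  direction \<open>e\<close>. The coordinate along \<open>e\<close> inverts the resulting parametrization of the arc.\<close>

context
  fixes \<phi> :: "'b::euclidean_space \<Rightarrow> 'a::euclidean_space" and \<phi>' :: "'b \<Rightarrow> 'b \<Rightarrow>\<^sub>L 'a"
    and W V \<psi> x r and e :: 'b
  assumes hom: "homeomorphism W V \<phi> \<psi>"
    and cont: "continuous_on W \<phi>'"
    and der: "\<And>y. y \<in> W \<Longrightarrow> (\<phi> has_derivative blinfun_apply (\<phi>' y)) (at y)"
    and inj: "\<And>y. y \<in> W \<Longrightarrow> inj (blinfun_apply (\<phi>' y))"
    and r: "r > 0" and ball: "ball x r \<subseteq> W" and e: "norm e = 1"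
begin

lemma segment_in_chart: "t \<in> {-r<..<r} \<Longrightarrow> x + t *\<^sub>R e \<in> W"
  using ball e by (auto simp: dist_norm subset_iff)

lemma arc_subset: "(\<lambda>t. \<phi> (x + t *\<^sub>R e)) ` {-r<..<r} \<subseteq> V"
  using segment_in_chart hom by (auto simp: homeomorphism_def)

lemma arc_has_derivative:
  "x + t *\<^sub>R e \<in> W \<Longrightarrow>
   ((\<lambda>t. \<phi> (x + t *\<^sub>R e)) has_derivative (\<lambda>s. \<phi>' (x + t *\<^sub>R e) (s *\<^sub>R e))) (at t)"
  by (rule has_derivative_compose[OF _ der]) (auto intro!: derivative_eq_intros)

lemma C1_curve_arc: "C1_curve ((\<lambda>t. \<phi> (x + t *\<^sub>R e)) ` {-r<..<r})" (is "C1_curve ?c")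
proof -
  let ?I = "{-r<..<r}" and ?\<gamma> = "\<lambda>t. \<phi> (x + t *\<^sub>R e)"
  have "homeomorphism ?I ?c ?\<gamma> (\<lambda>y. (\<psi> y - x) \<bullet> e)"
    unfolding homeomorphism_def
  proof (intro conjI ballI)
    have ee: "e \<bullet> e = 1" using e by (simp add: norm_eq_1)
    show inv: "(\<psi> (?\<gamma> t) - x) \<bullet> e = t" if "t \<in> ?I" for t
      using segment_in_chart[OF that] hom ee by (simp add: homeomorphism_def)
    show "(\<lambda>y. (\<psi> y - x) \<bullet> e) ` ?c = ?I"
      unfolding image_image using image_cong[OF refl inv, of ?I] by simp
    show "?\<gamma> ((\<psi> y - x) \<bullet> e) = y" if y: "y \<in> ?c" for y
    proof -
      from y obtain t where "t \<in> ?I" "y = ?\<gamma> t" by (rule imageE)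
      then show ?thesis by (simp only: inv)
    qed
    show "continuous_on ?I ?\<gamma>"
    proof (rule continuous_on_compose2[of W \<phi>])
      show "continuous_on W \<phi>" using hom by (simp add: homeomorphism_def)
    qed (use segment_in_chart in \<open>auto intro!: continuous_intros\<close>)
    have "continuous_on V \<psi>" using hom by (simp add: homeomorphism_def)
    then have "continuous_on ?c \<psi>" by (rule continuous_on_subset[OF _ arc_subset])
    then show "continuous_on ?c (\<lambda>y. (\<psi> y - x) \<bullet> e)"
      by (intro continuous_intros)
  qed (rule refl)
  moreover have "continuous_on ?I (\<lambda>t. \<phi>' (x + t *\<^sub>R e) o\<^sub>L blinfun_scaleR_left e)"
  proof -
    have "continuous_on ?I (\<lambda>t. \<phi>' (x + t *\<^sub>R e))"
      by (rule continuous_on_compose2[OF cont])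
        (use segment_in_chart in \<open>auto intro!: continuous_intros\<close>)
    then show ?thesis by (intro continuous_intros)
  qed
  moreover have "(?\<gamma> has_derivative blinfun_apply (\<phi>' (x + t *\<^sub>R e) o\<^sub>L blinfun_scaleR_left e)) (at t)"
    if "t \<in> ?I" for t
  proof -
    have "blinfun_apply (\<phi>' (x + t *\<^sub>R e) o\<^sub>L blinfun_scaleR_left e) = (\<lambda>s. \<phi>' (x + t *\<^sub>R e) (s *\<^sub>R e))"
      by (simp add: fun_eq_iff)
    then show ?thesis
      using arc_has_derivative[OF segment_in_chart[OF that]] by simp
  qed
  moreover have "inj (blinfun_apply (\<phi>' (x + t *\<^sub>R e) o\<^sub>L blinfun_scaleR_left e))"
    if "t \<in> ?I" for t
  proof (rule injI)
    fix s s'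
    assume "blinfun_apply (\<phi>' (x + t *\<^sub>R e) o\<^sub>L blinfun_scaleR_left e) s =
      blinfun_apply (\<phi>' (x + t *\<^sub>R e) o\<^sub>L blinfun_scaleR_left e) s'"
    then have "\<phi>' (x + t *\<^sub>R e) (s *\<^sub>R e) = \<phi>' (x + t *\<^sub>R e) (s' *\<^sub>R e)"
      by simp
    then have "s *\<^sub>R e = s' *\<^sub>R e"
      by (rule injD[OF inj[OF segment_in_chart[OF that]]])
    moreover have "e \<noteq> 0" using e by auto
    ultimately show "s = s'" by simp
  qed
  ultimately have param: "regular_param ?\<gamma> ?I ?c"
    unfolding regular_param_def
    by (intro conjI exI[of _ "\<lambda>y. (\<psi> y - x) \<bullet> e"]
        exI[of _ "\<lambda>t. \<phi>' (x + t *\<^sub>R e) o\<^sub>L blinfun_scaleR_left e"])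
      (assumption | simp)+
  show ?thesis
    unfolding C1_curve_def
  proof (intro conjI ballI exI)
    show "?c \<noteq> {}" using r by auto
    show "openin (top_of_set ?c) ?c" by (rule openin_subtopology_self)
  qed (assumption, rule param)
qed

lemma tangent_space_arc:
  "\<phi>' x (s *\<^sub>R e) \<in> tangent_space ((\<lambda>t. \<phi> (x + t *\<^sub>R e)) ` {-r<..<r}) (\<phi> x)"
proof (rule tangent_spaceI[where \<phi> = \<phi>])
  show "(\<phi> has_derivative \<phi>' x) (at x)"
    by (rule der) (use ball r in auto)
  have "((\<lambda>t. t * s) \<longlongrightarrow> 0 * s) (at 0)" by (intro tendsto_intros)
  then have "\<forall>\<^sub>F t in at 0. t * s \<in> {-r<..<r}"
    using r by (intro topological_tendstoD) auto
  then show "\<forall>\<^sub>F t in at 0. \<phi> (x + t *\<^sub>R s *\<^sub>R e) \<in> (\<lambda>t. \<phi> (x + t *\<^sub>R e)) ` {-r<..<r}"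
    by eventually_elim auto
qed

end

text \<open>The arcs are images of segments of the same length along the two coordinate axes through
  \<open>x\<close>. In the chart they form a cross, whose centre is the only common point and in which each
  segment is cut out by the vanishing of the other coordinate, hence is relatively closed.\<close>

lemma exists_crossing:
  fixes S :: "'a::euclidean_space set"
  assumes "C1_surface S"
  obtains C where "curve_arrangement S C" "Psi2 C = 1"
proof -
  obtain p where "p \<in> S" using assms by (auto simp: C1_surface_def)
  then obtain \<phi> :: "real^2 \<Rightarrow> 'a" and W V where V: "openin (top_of_set S) V" "p \<in> V"
    and "regular_param \<phi> W V"
    using assms unfolding C1_surface_def by meson
  then obtain \<psi> \<phi>' where W: "open W" and hom: "homeomorphism W V \<phi> \<psi>"
    and cont: "continuous_on W \<phi>'"
    and der: "\<And>y. y \<in> W \<Longrightarrow> (\<phi> has_derivative blinfun_apply (\<phi>' y)) (at y)"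
    and inj: "\<And>y. y \<in> W \<Longrightarrow> inj (blinfun_apply (\<phi>' y))"
    unfolding regular_param_def by blast
  define x where "x = \<psi> p"
  have x: "x \<in> W" "\<phi> x = p" using hom V(2) by (auto simp: homeomorphism_def x_def)
  obtain r where r: "r > 0" "ball x r \<subseteq> W" using W x(1) by (meson openE)
  define arc where "arc i = (\<lambda>t. \<phi> (x + t *\<^sub>R axis i 1)) ` {-r<..<r}" for i :: 2
  define C where "C = {arc 1, arc 2}"
  have chart: "x + t *\<^sub>R axis i 1 \<in> W" if "t \<in> {-r<..<r}" for t and i :: 2
    using segment_in_chart[OF hom cont der inj r _ that] by (simp add: norm_axis_1)
  have curve: "C1_curve (arc i)" for i
    unfolding arc_def by (rule C1_curve_arc[OF hom cont der inj r]) (simp_all add: norm_axis_1)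
  have sub: "arc i \<subseteq> V" for i
    unfolding arc_def by (rule arc_subset[OF hom cont der inj r]) (simp_all add: norm_axis_1)
  have VS: "V \<subseteq> S" using V(1) by (meson openin_imp_subset)
  have tangent: "\<phi>' x (s *\<^sub>R axis i 1) \<in> tangent_space (arc i) p" for s i
    unfolding arc_def x(2)[symmetric]
    by (rule tangent_space_arc[OF hom cont der inj r]) (simp_all add: norm_axis_1)
  have cross: "arc i \<inter> arc j = {p}" if "i \<noteq> j" for i j
  proof (intro equalityI subsetI)
    fix y assume "y \<in> arc i \<inter> arc j"
    then obtain s t where s: "s \<in> {-r<..<r}" "y = \<phi> (x + s *\<^sub>R axis i 1)"
      and t: "t \<in> {-r<..<r}" "y = \<phi> (x + t *\<^sub>R axis j 1)"
      by (auto simp: arc_def)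
    have "x + s *\<^sub>R axis i 1 = x + t *\<^sub>R axis j 1"
      using s(2) t(2) chart[OF s(1)] chart[OF t(1)] hom by (metis homeomorphism_apply1)
    then have "(s *\<^sub>R axis i 1 :: real^2) $ i = (t *\<^sub>R axis j 1 :: real^2) $ i" by simp
    then have "s = 0" using \<open>i \<noteq> j\<close> by (simp add: axis_def)
    then show "y \<in> {p}" using s(2) x(2) by simp
  next
    fix y assume "y \<in> {p}"
    then show "y \<in> arc i \<inter> arc j"
      using r(1) x(2) by (auto simp: arc_def image_iff intro!: bexI[of _ 0])
  qed
  have far: "\<phi> (x + (r / 2) *\<^sub>R axis i 1) \<in> arc i - {p}" for i
  proof -
    have "\<phi> (x + (r / 2) *\<^sub>R axis i 1) \<noteq> \<phi> x"
    proof
      assume "\<phi> (x + (r / 2) *\<^sub>R axis i 1) = \<phi> x"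
      moreover have "x + (r / 2) *\<^sub>R axis i 1 \<in> W"
        using r(1) by (intro chart) simp
      ultimately have "x + (r / 2) *\<^sub>R axis i 1 = x"
        using x(1) hom by (metis homeomorphism_apply1)
      then show False using r(1) by (simp add: axis_eq_0_iff)
    qed
    then show ?thesis using r(1) x(2) by (auto simp: arc_def)
  qed
  have "arc 1 \<noteq> arc 2"
    using cross[of 1 2] far[of 1] by auto
  have ne: "c = arc 1 \<and> c' = arc 2 \<or> c = arc 2 \<and> c' = arc 1"
    if "c \<in> C" "c' \<in> C" "c \<noteq> c'" for c c'
    using that by (auto simp: C_def)
  have p_arc: "p \<in> arc i" for i
    using cross[of i "i + 1"] by auto
  have Sing: "Sing C = {p}"
  proof (intro equalityI subsetI)
    fix v assume "v \<in> Sing C"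
    then have "v \<in> arc 1 \<inter> arc 2" by (auto simp: Sing_def C_def)
    then show "v \<in> {p}" using cross[of 1 2] by simp
  qed (use \<open>arc 1 \<noteq> arc 2\<close> p_arc in \<open>auto simp: Sing_def C_def\<close>)
  have num: "num_curves C p = 2"
  proof -
    have "{c \<in> C. p \<in> c} = C" using p_arc by (auto simp: C_def)
    then show ?thesis using \<open>arc 1 \<noteq> arc 2\<close> by (simp add: num_curves_def C_def)
  qed
  have tangent_S: "tangent_space S p \<subseteq> range (\<phi>' x)"
    using tangent_space_subset_range[OF V(1) hom x(1) der inj] x by simp
  have range_S: "\<phi>' x h \<in> tangent_space S p" for h
  proof -
    have "((\<lambda>t. x + t *\<^sub>R h) \<longlongrightarrow> x + 0 *\<^sub>R h) (at 0)" by (intro tendsto_intros)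
    then have "\<forall>\<^sub>F t in at 0. x + t *\<^sub>R h \<in> W"
      using W x(1) by (intro topological_tendstoD) auto
    then have "\<forall>\<^sub>F t in at 0. \<phi> (x + t *\<^sub>R h) \<in> S"
      by eventually_elim (use hom VS in \<open>auto simp: homeomorphism_def\<close>)
    then show ?thesis
      using tangent_spaceI[OF der[OF x(1)]] x(2) by simp
  qed
  have trans: "transverse_at S (arc i) (arc j) p" if "i \<noteq> j" for i j
    unfolding transverse_at_def
  proof (intro equalityI subsetI)
    fix w assume "w \<in> tangent_space S p"
    then obtain h where h: "w = \<phi>' x h" using tangent_S by blast
    have "h = (h $ i) *\<^sub>R axis i 1 + (h $ j) *\<^sub>R axis j 1"
      using that exhaust_2 by (simp add: vec_eq_iff axis_def) metis
    then have "w = \<phi>' x ((h $ i) *\<^sub>R axis i 1) + \<phi>' x ((h $ j) *\<^sub>R axis j 1)"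
      using h by (metis blinfun.add_right)
    then show "w \<in> {u + w |u w. u \<in> tangent_space (arc i) p \<and> w \<in> tangent_space (arc j) p}"
      using tangent by blast
  next
    fix w assume "w \<in> {u + w |u w. u \<in> tangent_space (arc i) p \<and> w \<in> tangent_space (arc j) p}"
    then obtain u1 u2 where "w = u1 + u2" "u1 \<in> tangent_space S p" "u2 \<in> tangent_space S p"
      using tangent_space_mono[OF order_trans[OF sub VS]] by blast
    moreover from this obtain h1 h2 where "u1 = \<phi>' x h1" "u2 = \<phi>' x h2"
      using tangent_S by blast
    ultimately show "w \<in> tangent_space S p"
      using range_S[of "h1 + h2"] by (simp add: blinfun.add_right)
  qed
  have closed: "closedin (top_of_set (\<Union>C)) (arc i)" for i
  proof -
    have un: "\<Union>C = arc 1 \<union> arc 2" by (simp add: C_def)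
    define Z where "Z = {y :: real^2. \<forall>j. j \<noteq> i \<longrightarrow> (y - x) $ j = 0}"
    have "closed Z"
      unfolding Z_def by (intro closed_Collect_all closed_Collect_imp closed_Collect_eq
          continuous_intros open_Collect_const)
    moreover have "continuous_on (\<Union>C) \<psi>"
      using hom sub un by (auto simp: homeomorphism_def intro: continuous_on_subset)
    ultimately have "closedin (top_of_set (\<Union>C)) (\<Union>C \<inter> \<psi> -` Z)"
      by (rule continuous_closedin_preimage[rotated])
    moreover have "\<Union>C \<inter> \<psi> -` Z = arc i"
    proof -
      have \<psi>: "\<psi> (\<phi> (x + t *\<^sub>R axis k 1)) = x + t *\<^sub>R axis k 1" if "t \<in> {-r<..<r}" for t k
        using chart[OF that] hom by (simp add: homeomorphism_def)
      have "arc k \<inter> \<psi> -` Z \<subseteq> arc i" for k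
      proof (cases "k = i")
        case False
        show ?thesis
        proof
          fix y assume "y \<in> arc k \<inter> \<psi> -` Z"
          then obtain t where t: "t \<in> {-r<..<r}" "y = \<phi> (x + t *\<^sub>R axis k 1)"
            and "x + t *\<^sub>R axis k 1 \<in> Z"
            using \<psi> by (auto simp: arc_def)
          then have "t = 0" using False by (auto simp: Z_def axis_def)
          then show "y \<in> arc i" using t(2) x(2) p_arc by simp
        qed
      qed auto
      moreover have "arc i \<subseteq> \<psi> -` Z"
        using \<psi> by (auto simp: arc_def Z_def axis_def)
      moreover have "arc i \<subseteq> \<Union>C" using exhaust_2[of i] by (auto simp: C_def)
      ultimately show ?thesis unfolding un by blast
    qed
    ultimately show ?thesis by simp
  qed
  show ?thesis
  proof
    show "curve_arrangement S C"
      unfolding curve_arrangement_def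
    proof (intro conjI ballI allI impI)
      fix c assume "c \<in> C"
      then obtain i where c: "c = arc i" by (auto simp: C_def)
      show "C1_curve c" "c \<subseteq> S" "closedin (top_of_set (\<Union>C)) c"
        using c curve sub VS closed by auto
    next
      fix c c' q assume "c \<in> C" "c' \<in> C" and q: "c \<noteq> c' \<and> q \<in> c \<and> q \<in> c'"
      then obtain i j where "i \<noteq> j" "c = arc i" "c' = arc j"
        using ne[of c c'] by (metis one_neq_zero zero_neq_one)
      moreover have "q = p"
        using cross[OF \<open>i \<noteq> j\<close>] q calculation by auto
      ultimately show "transverse_at S c c' q" using trans by simp
    next
      fix v
      show "branch_number C v = 2 * num_curves C v"
        by (rule branch_number_eq) (use curve in \<open>auto simp: C_def\<close>)
    qed (simp_all add: Sing, simp add: C_def)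
    show "Psi2 C = 1"
      by (simp add: Psi2_def Sing num)
  qed
qed

theorem propositionB7:
  fixes S :: "'a::euclidean_space set"
    and I :: "'a set set \<Rightarrow> 'g::ab_group_add"
  assumes "C1_surface S"
    and "linearly_locally_additive S I"
  shows "\<exists>!\<alpha>. \<forall>C. curve_arrangement S C \<longrightarrow> I C = nat_multiple \<alpha> (Psi2 C)"
proof -
  obtain F \<alpha> where "I {} = 0"
    and "\<And>C H. curve_arrangement S C \<Longrightarrow> H \<in> C \<Longrightarrow> I C - I (C - {H}) = F (Loc H C)"
    and "\<And>C H. curve_arrangement S C \<Longrightarrow> H \<in> C \<Longrightarrow>
      F (Loc H C) = (\<Sum>v\<in>H \<inter> Sing C. F {#branch_number C v#})"
    and "\<And>j. j \<ge> 2 \<Longrightarrow> F {#2 * j#} = nat_multiple \<alpha> (j - 1)"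
    using assms(2) unfolding linearly_locally_additive_def by blast
  then have \<alpha>: "I C = nat_multiple \<alpha> (Psi2 C)" if "curve_arrangement S C" for C
    using invariant_eq_multiple_Psi2[of I S F \<alpha> C] that by simp
  obtain X where X: "curve_arrangement S X" "Psi2 X = 1"
    using exists_crossing[OF assms(1)] .
  show ?thesis
  proof
    show "\<forall>C. curve_arrangement S C \<longrightarrow> I C = nat_multiple \<alpha> (Psi2 C)"
      using \<alpha> by blast
  next
    fix \<beta> assume "\<forall>C. curve_arrangement S C \<longrightarrow> I C = nat_multiple \<beta> (Psi2 C)"
    then have "I X = \<beta>" using X by simp
    then show "\<beta> = \<alpha>" using \<alpha>[OF X(1)] X(2) by simp
  qed
qed

end
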